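(* There is a universal constant $c$ (independent of all problem parameters) such that the following holds. Consider the caching problem with files $\mathcal{N}=\{1,\dots,N\}$ having popularities $p_1\ge p_2\ge\dots\ge p_N>0$, $K$ users, and normalized cache size $M\ge 0$. Let $\mathcal{N}_1,\dots,\mathcal{N}_L$ be the maximal partition of $\mathcal{N}$ to within popularity factor two, let $N_\ell=|\mathcal{N}_\ell|$, and let $\mathsf{K}_\ell$ be the random number of users whose demand lies in $\mathcal{N}_\ell$. Then \[ R^\star(M,\mathcal{N},K)\;\ge\;\frac{1}{cL}\sum_{\ell=1}^L \mathbb{E}\bigl(R(M,N_\ell,\mathsf{K}_\ell)\bigr). \]
   Context: Caching problem: a server holds $N$ files, each of $F$ bits, connected through a shared error-free link to $K$ users, each with a cache of $MF$ bits. In the placement phase (before demands are known), each user stores an arbitrary function of the files of at most $MF$ bits. In the delivery phase each user $k$ independently requests file $\mathsf{d}_k$ with $\Pr(\mathsf{d}_k=n)=p_n$; the server sends a message over the shared link from which, together with its cache, each user must reconstruct its requested file. The rate for a demand vector is the message length divided by $F$; $R^\star(M,\mathcal{N},K)$ denotes the infimum of expected rates (expectation over demands) achievable with vanishing error probability for all sufficiently large $F$, over all schemes. Maximal partition to within popularity factor two: $\mathcal{N}_1=\{1,\dots,N_1\}$ where $N_1$ is the largest index with $p_{N_1}\ge p_1/2$; recursively, if $n$ is the smallest file not yet assigned, the next group is $\{n,\dots,n+N_\ell-1\}$ with $p_{n+N_\ell-1}\ge p_n/2$ and $p_{n+N_\ell}<p_n/2$ (or $n+N_\ell-1=N$); $L$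 is the number of groups. $\mathsf{K}_\ell$ is Binomial$(K,\sum_{n\in\mathcal{N}_\ell}p_n)$. The function $R$ is defined for real $M\ge0$ and integers $N\ge1,K\ge0$ by $R(M,N,K)=(1-M/N)\min\{\tfrac{N}{M}(1-(1-M/N)^K),N\}$ for $M\in(0,N]$, $R(0,N,K)=\min\{N,K\}$, and $R(M,N,K)=0$ for $M>N$. *)

theory Defs
  imports "HOL-Probability.Probability"
begin

definition Rfun :: "real \<Rightarrow> nat \<Rightarrow> nat \<Rightarrow> real" where
  "Rfun M N K =
     (if M = 0 then real (min N K)
      else if 0 < M \<and> M \<le> real N then
        (1 - M / real N) * min (real N / M * (1 - (1 - M / real N) ^ K)) (real N)
      else 0)"

text \<open>Files are indexed by 1..N, users by 0..K-1. A library is an assignment of an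
  F-bit string to each file (other indices carry the empty list).\<close>

definition libraries :: "nat \<Rightarrow> nat \<Rightarrow> (nat \<Rightarrow> bool list) set" where
  "libraries N F = {W. (\<forall>n\<in>{1..N}. length (W n) = F) \<and> (\<forall>n. n \<notin> {1..N} \<longrightarrow> W n = [])}"

definition demands :: "nat \<Rightarrow> nat \<Rightarrow> (nat \<Rightarrow> nat) set" where
  "demands N K = PiE {..<K} (\<lambda>_. {1..N})"

definition demand_prob :: "(nat \<Rightarrow> real) \<Rightarrow> nat \<Rightarrow> (nat \<Rightarrow> nat) \<Rightarrow> real" where
  "demand_prob p K d = (\<Prod>k<K. p (d k))"

definition error_prob ::
  "nat \<Rightarrow> nat \<Rightarrow> nat \<Rightarrow> (nat \<Rightarrow> (nat \<Rightarrow> bool list) \<Rightarrow> bool list)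
   \<Rightarrow> ((nat \<Rightarrow> nat) \<Rightarrow> (nat \<Rightarrow> bool list) \<Rightarrow> bool list)
   \<Rightarrow> (nat \<Rightarrow> (nat \<Rightarrow> nat) \<Rightarrow> bool list \<Rightarrow> bool list \<Rightarrow> bool list)
   \<Rightarrow> (nat \<Rightarrow> nat) \<Rightarrow> real" where
  "error_prob N K F cache msg dec d =
     real (card {W \<in> libraries N F. \<exists>k<K. dec k d (msg d W) (cache k W) \<noteq> W (d k)})
     / real (card (libraries N F))"

definition good_scheme :: "real \<Rightarrow> nat \<Rightarrow> nat \<Rightarrow> (nat \<Rightarrow> real) \<Rightarrow> nat \<Rightarrow> real \<Rightarrow> real \<Rightarrow> bool" where
  "good_scheme M N K p F eps R \<longleftrightarrow>
     (\<exists>cache msg dec len.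
        (\<forall>k<K. \<forall>W\<in>libraries N F. real (length (cache k W)) \<le> M * real F) \<and>
        (\<forall>d\<in>demands N K. \<forall>W\<in>libraries N F. length (msg d W) = len d) \<and>
        (\<forall>d\<in>demands N K. error_prob N K F cache msg dec d \<le> eps) \<and>
        (\<Sum>d\<in>demands N K. demand_prob p K d * (real (len d) / real F)) \<le> R)"

definition achievable :: "real \<Rightarrow> nat \<Rightarrow> nat \<Rightarrow> (nat \<Rightarrow> real) \<Rightarrow> real \<Rightarrow> bool" where
  "achievable M N K p R \<longleftrightarrow>
     (\<forall>eps>0. \<exists>F0. \<forall>F\<ge>F0. good_scheme M N K p F eps (R + eps))"

definition Rstar :: "real \<Rightarrow> nat \<Rightarrow> nat \<Rightarrow> (nat \<Rightarrow> real) \<Rightarrow> real" where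
  "Rstar M N K p = Inf {R. achievable M N K p R}"

definition grp_end :: "(nat \<Rightarrow> real) \<Rightarrow> nat \<Rightarrow> nat \<Rightarrow> nat" where
  "grp_end p N n = Max {m \<in> {n..N}. p m \<ge> p n / 2}"

fun grp_start :: "(nat \<Rightarrow> real) \<Rightarrow> nat \<Rightarrow> nat \<Rightarrow> nat" where
  "grp_start p N 0 = 1"
| "grp_start p N (Suc l) = grp_end p N (grp_start p N l) + 1"

definition num_groups :: "(nat \<Rightarrow> real) \<Rightarrow> nat \<Rightarrow> nat" where
  "num_groups p N = (LEAST l. grp_start p N l > N)"

definition group :: "(nat \<Rightarrow> real) \<Rightarrow> nat \<Rightarrow> nat \<Rightarrow> nat set" where
  "group p N l = {grp_start p N l .. grp_end p N (grp_start p N l)}"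

end

theory Submission
  imports Defs
begin

text \<open>
  It suffices to bound the rate from below by each single group \<open>G\<close>, with \<open>n\<close> files, and to average.
  Condition on the set \<open>T\<close> of users whose demand lies in \<open>G\<close>. A cut-set argument, done by counting
  libraries, shows that for any \<open>s\<close> users and any \<open>b\<close> demand vectors the \<open>b\<close> rates sum up to at
  least the number of distinct files these users request, minus \<open>s M\<close> and a term that vanishes
  with growing file length. Given \<open>T\<close>, each user in \<open>T\<close> requests every file of \<open>G\<close> with
  probability at least \<open>1 / (2 n)\<close>, so two averages of this bound are available. Letting one user of
  \<open>T\<close> run through all of \<open>G\<close> gives conditional expected rate at least \<open>(n - M) / (2 n)\<close>; taking \<open>b\<close>
  independent demand vectors and \<open>s \<le> |T|\<close> users gives at least
  \<open>(n (1 - (1 - 1 / (2 n)) ^ (s b)) - s M) / b\<close>. The first (for \<open>M > n / 16\<close>) or the second dominates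
  \<open>Rfun M n |T|\<close> up to a constant for every single \<open>T\<close>, and since \<open>|T|\<close> is binomial no
  concentration estimate is needed.
\<close>

section \<open>The cut-set bound\<close>

lemma finite_bool_lists_length [simp]: "finite {xs :: bool list. length xs = m}"
  using finite_lists_length_eq[of "UNIV :: bool set" m] by simp

lemma card_bool_lists_length [simp]: "card {xs :: bool list. length xs = m} = 2 ^ m"
  using card_lists_length_eq[of "UNIV :: bool set" m] by (simp add: card_UNIV_bool)

lemma finite_bool_lists_length_le [simp]: "finite {xs :: bool list. length xs \<le> m}"
  using finite_lists_length_le[of "UNIV :: bool set" m] by simp

lemma card_bool_lists_length_le: "card {xs :: bool list. length xs \<le> m} \<le> 2 ^ (m + 1)"
proof -
  have "card {xs :: bool list. length xs \<le> m} = (\<Sum>i\<le>m. 2 ^ i)"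
    using card_lists_length_le[of "UNIV :: bool set" m] by (simp add: card_UNIV_bool)
  also have "\<dots> \<le> 2 ^ (m + 1)"
    by (induction m) auto
  finally show ?thesis .
qed

lemma libraries_eq_PiE_dflt: "libraries N F = PiE_dflt {1..N} [] (\<lambda>_. {xs. length xs = F})"
  unfolding libraries_def PiE_dflt_def by blast

lemma finite_libraries [simp]: "finite (libraries N F)"
  unfolding libraries_eq_PiE_dflt by (rule finite_PiE_dflt) auto

lemma card_libraries: "card (libraries N F) = 2 ^ (F * N)"
  unfolding libraries_eq_PiE_dflt by (subst card_PiE_dflt) (simp_all add: power_mult)

lemma finite_demands [simp]: "finite (demands N K)"
  by (simp add: demands_def finite_PiE)

lemma demand_prob_nonneg:
  assumes "\<And>n. n \<in> {1..N} \<Longrightarrow> 0 \<le> p n" "d \<in> demands N K"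
  shows "0 \<le> demand_prob p K d"
  unfolding demand_prob_def
proof (intro prod_nonneg assms(1))
  show "d k \<in> {1..N}" if "k \<in> {..<K}" for k
    using assms(2) that unfolding demands_def by (rule PiE_mem)
qed

text \<open>Where decoding succeeds for all of \<open>J\<close>, the caches of \<open>S\<close>, the
  messages for \<open>J\<close> and the files outside the requested set determine the library. At
  least half of all libraries are therefore encoded injectively, and exponents of two are compared.
  The leading \<open>1\<close> pays for that half; \<open>m + 1\<close> instead of \<open>m\<close>
  pays for cache contents of every length up to \<open>m\<close>.\<close>

lemma cut_set_count:
  fixes S J :: "nat set" and d :: "nat \<Rightarrow> nat \<Rightarrow> nat"
  assumes cache: "\<And>k W. k \<in> S \<Longrightarrow> W \<in> libraries N F \<Longrightarrow> length (cache k W) \<le> m"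
    and msg: "\<And>j W. j \<in> J \<Longrightarrow> W \<in> libraries N F \<Longrightarrow> length (msg (d j) W) = len (d j)"
    and err: "\<And>j. j \<in> J \<Longrightarrow> error_prob N K F cache msg dec (d j) \<le> eps"
    and eps: "real (card J) * eps \<le> 1/2"
    and S: "S \<subseteq> {..<K}" and J: "finite J"
    and d: "\<And>j k. j \<in> J \<Longrightarrow> k \<in> S \<Longrightarrow> d j k \<in> {1..N}"
  shows "F * card (\<Union>j\<in>J. d j ` S) \<le> 1 + (m + 1) * card S + (\<Sum>j\<in>J. len (d j))"
proof -
  define L where "L = libraries N F"
  define D where "D = (\<Union>j\<in>J. d j ` S)"
  define Bad where "Bad j = {W \<in> L. \<exists>k<K. dec k (d j) (msg (d j) W) (cache k W) \<noteq> W (d j k)}" for j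
  define A where "A = L - (\<Union>j\<in>J. Bad j)"
  have finS: "finite S" using S finite_subset by blast
  have finL: "finite L" by (simp add: L_def)
  have DN: "D \<subseteq> {1..N}" using d unfolding D_def by blast
  have cardL: "card L = 2 ^ (F * N)" by (simp add: L_def card_libraries)
  have bad: "real (card (Bad j)) \<le> eps * card L" if "j \<in> J" for j
    using err[OF that] cardL unfolding error_prob_def Bad_def L_def by (simp add: field_simps)
  \<comment> \<open>Union bound: all demand vectors of \<open>J\<close> together spoil at most half
    of the libraries.\<close>
  have "real (card (\<Union>j\<in>J. Bad j)) \<le> (\<Sum>j\<in>J. real (card (Bad j)))"
    using card_UN_le[OF J, of Bad] by (metis of_nat_le_iff of_nat_sum)
  also have "\<dots> \<le> (\<Sum>j\<in>J. eps * card L)" by (intro sum_mono bad)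
  also have "\<dots> = (real (card J) * eps) * card L" by simp
  also have "\<dots> \<le> 1/2 * card L" by (intro mult_right_mono eps) simp
  finally have "2 * card (\<Union>j\<in>J. Bad j) \<le> card L" by linarith
  moreover have "card A \<ge> card L - card (\<Union>j\<in>J. Bad j)"
    unfolding A_def by (rule diff_card_le_card_Diff) (use finL J in \<open>auto simp: Bad_def\<close>)
  ultimately have halfL: "card L \<le> 2 * card A" by linarith
  \<comment> \<open>The restrictions place the three components in the product sets
    \<open>B1\<close>, \<open>B2\<close>, \<open>B3\<close>, whose sizes are bounded by powers of
    two.\<close>
  define Code where "Code W = (restrict (\<lambda>k. cache k W) S, restrict (\<lambda>j. msg (d j) W) J,
      restrict W ({1..N} - D))" for W
  define B1 where "B1 = PiE S (\<lambda>_. {xs :: bool list. length xs \<le> m})"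
  define B2 where "B2 = PiE J (\<lambda>j. {xs :: bool list. length xs = len (d j)})"
  define B3 where "B3 = PiE ({1..N} - D) (\<lambda>_. {xs :: bool list. length xs = F})"
  have inj: "inj_on Code A"
  proof (rule inj_onI)
    fix V W assume V: "V \<in> A" and W: "W \<in> A" and eq: "Code V = Code W"
    have "restrict (\<lambda>k. cache k V) S = restrict (\<lambda>k. cache k W) S"
      "restrict (\<lambda>j. msg (d j) V) J = restrict (\<lambda>j. msg (d j) W) J"
      "restrict V ({1..N} - D) = restrict W ({1..N} - D)"
      using eq unfolding Code_def by auto
    note eqs = this[THEN fun_cong]
    have c: "cache k V = cache k W" if "k \<in> S" for k
      using eqs(1)[of k] that by simp
    have x: "msg (d j) V = msg (d j) W" if "j \<in> J" for j
      using eqs(2)[of j] that by simp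
    have r: "V n = W n" if "n \<in> {1..N} - D" for n
      using eqs(3)[of n] that by simp
    show "V = W"
    proof
      fix n
      consider "n \<notin> {1..N}" | "n \<in> {1..N} - D" | "n \<in> D" by blast
      then show "V n = W n"
      proof cases
        case 1 then show ?thesis using V W by (simp add: A_def L_def libraries_def)
      next
        case 2 then show ?thesis by (rule r)
      next
        case 3
        \<comment> \<open>A requested file is what a user of \<open>S\<close> decodes, and both
          decoder inputs agree for \<open>V\<close> and \<open>W\<close>.\<close>
        then obtain j k where jk: "j \<in> J" "k \<in> S" "n = d j k" unfolding D_def by blast
        have dec: "dec k (d j) (msg (d j) U) (cache k U) = U (d j k)" if "U \<in> A" for U
          using that jk S unfolding A_def Bad_def by blast
        show ?thesis using dec[OF V] dec[OF W] c[OF jk(2)] x[OF jk(1)] jk(3) by simp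
      qed
    qed
  qed
  have AL: "W \<in> libraries N F" if "W \<in> A" for W using that by (simp add: A_def L_def)
  have "Code W \<in> B1 \<times> B2 \<times> B3" if "W \<in> A" for W
  proof -
    have "length (W n) = F" if "n \<in> {1..N} - D" for n
      using AL[OF \<open>W \<in> A\<close>] that by (simp add: libraries_def)
    then show ?thesis
      unfolding Code_def B1_def B2_def B3_def mem_Times_iff fst_conv snd_conv restrict_PiE_iff
      using cache[OF _ AL[OF that]] msg[OF _ AL[OF that]] by blast
  qed
  then have sub: "Code ` A \<subseteq> B1 \<times> B2 \<times> B3" by blast
  have fin: "finite B1" "finite B2" "finite B3"
    using finS J by (auto simp: B1_def B2_def B3_def intro!: finite_PiE)
  have "card B1 = card {xs :: bool list. length xs \<le> m} ^ card S"
    unfolding B1_def using finS by (simp add: card_PiE)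
  also have "\<dots> \<le> (2 ^ (m + 1)) ^ card S"
    by (rule power_mono[OF card_bool_lists_length_le]) simp
  finally have c1: "card B1 \<le> 2 ^ ((m + 1) * card S)"
    by (simp only: power_mult)
  have c2: "card B2 = 2 ^ (\<Sum>j\<in>J. len (d j))"
    unfolding B2_def using J by (simp add: card_PiE power_sum)
  have c3: "card B3 = 2 ^ (F * (N - card D))"
    unfolding B3_def using DN by (simp add: card_PiE power_mult card_Diff_subset finite_subset)
  have "card A \<le> card (B1 \<times> B2 \<times> B3)"
    by (rule card_inj_on_le[OF inj sub]) (use fin in auto)
  also have "\<dots> \<le> 2 ^ ((m + 1) * card S) * (2 ^ (\<Sum>j\<in>J. len (d j)) * 2 ^ (F * (N - card D)))"
    using c1 by (simp add: card_cartesian_product c2 c3)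
  finally have "2 ^ (F * N) \<le> 2 * (2 ^ ((m + 1) * card S) *
      (2 ^ (\<Sum>j\<in>J. len (d j)) * 2 ^ (F * (N - card D))) :: nat)"
    using halfL cardL by linarith
  also have "\<dots> = 2 ^ (1 + (m + 1) * card S + (\<Sum>j\<in>J. len (d j)) + F * (N - card D))"
    by (simp add: power_add mult_ac)
  finally have "F * N \<le> 1 + (m + 1) * card S + (\<Sum>j\<in>J. len (d j)) + F * (N - card D)"
    by (rule power_le_imp_le_exp[rotated]) simp
  moreover have "F * N = F * card D + F * (N - card D)"
    using card_mono[OF _ DN] by (simp flip: add_mult_distrib2)
  ultimately show ?thesis unfolding D_def by linarith
qed

text \<open>Isolates what the rest of the argument needs from a scheme; \<open>\<delta>\<close> is the reciprocal of the
  file length.\<close>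

definition cut_set_rates :: "real \<Rightarrow> nat \<Rightarrow> nat \<Rightarrow> real \<Rightarrow> ((nat \<Rightarrow> nat) \<Rightarrow> real) \<Rightarrow> bool" where
  "cut_set_rates M N K \<delta> r \<longleftrightarrow> (\<forall>d\<in>demands N K. 0 \<le> r d) \<and>
     (\<forall>J S d. finite J \<longrightarrow> card J \<le> N \<longrightarrow> S \<subseteq> {..<K} \<longrightarrow> (\<forall>j\<in>J. d j \<in> demands N K) \<longrightarrow>
        real (card (\<Union>j\<in>(J::nat set). d j ` S))
          \<le> (\<Sum>j\<in>J. r (d j)) + real (card S) * M + (real (card S) + 1) * \<delta>)"

text \<open>The rates are \<open>len d / F\<close>. For at most \<open>N\<close> demand vectors the
  error probabilities add up to at most 1/2, as the counting bound requires; division by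
  \<open>F\<close> turns its additive constants into multiples of \<open>1 / F\<close>.\<close>

lemma good_scheme_imp_cut_set_rates:
  assumes good: "good_scheme M N K p F eps R" and F: "F > 0" and M: "M \<ge> 0"
    and eps: "eps > 0" "real N * eps \<le> 1/2"
  shows "\<exists>r. cut_set_rates M N K (1 / real F) r \<and> (\<Sum>d\<in>demands N K. demand_prob p K d * r d) \<le> R"
proof -
  from good obtain cache msg dec len where
    c: "\<And>k W. k < K \<Longrightarrow> W \<in> libraries N F \<Longrightarrow> real (length (cache k W)) \<le> M * real F" and
    x: "\<And>d W. d \<in> demands N K \<Longrightarrow> W \<in> libraries N F \<Longrightarrow> length (msg d W) = len d" and
    e: "\<And>d. d \<in> demands N K \<Longrightarrow> error_prob N K F cache msg dec d \<le> eps" and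
    R: "(\<Sum>d\<in>demands N K. demand_prob p K d * (real (len d) / real F)) \<le> R"
    unfolding good_scheme_def by blast
  define m where "m = nat \<lfloor>M * real F\<rfloor>"
  have m: "real m \<le> M * real F" unfolding m_def using M by simp
  have cm: "length (cache k W) \<le> m" if "k < K" "W \<in> libraries N F" for k W
    using c[OF that] unfolding m_def by (simp add: le_nat_floor)
  have "real (card (\<Union>j\<in>J. d j ` S))
          \<le> (\<Sum>j\<in>J. real (len (d j)) / real F) + real (card S) * M + (real (card S) + 1) * (1 / real F)"
    if J: "finite J" "card J \<le> N" and S: "S \<subseteq> {..<K}" and d: "\<forall>j\<in>J. d j \<in> demands N K"
    for J S :: "nat set" and d
  proof -
    have "real (card J) * eps \<le> real N * eps" using J eps by (intro mult_right_mono) auto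
    with eps have Je: "real (card J) * eps \<le> 1/2" by linarith
    have "F * card (\<Union>j\<in>J. d j ` S) \<le> 1 + (m + 1) * card S + (\<Sum>j\<in>J. len (d j))"
    proof (rule cut_set_count[where cache = cache and msg = msg and dec = dec and eps = eps, OF _ _ _ Je S J(1)])
      show "d j k \<in> {1..N}" if "j \<in> J" "k \<in> S" for j k
      proof -
        have "k \<in> {..<K}" "d j \<in> PiE {..<K} (\<lambda>_. {1..N})" using that d S by (auto simp: demands_def)
        then show ?thesis by (rule PiE_mem[rotated])
      qed
    qed (use cm x e S d in auto)
    then have "real (F * card (\<Union>j\<in>J. d j ` S)) \<le> real (1 + (m + 1) * card S + (\<Sum>j\<in>J. len (d j)))"
      by (rule of_nat_mono)
    then have "real F * real (card (\<Union>j\<in>J. d j ` S)) \<le> 1 + (real m + 1) * real (card S) + (\<Sum>j\<in>J. real (len (d j)))"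
      by (simp add: algebra_simps)
    also have "\<dots> \<le> 1 + (M * real F + 1) * real (card S) + (\<Sum>j\<in>J. real (len (d j)))"
      using m by (intro add_mono mult_right_mono order_refl) auto
    finally have "real (card (\<Union>j\<in>J. d j ` S)) \<le> (1 + (M * real F + 1) * real (card S) + (\<Sum>j\<in>J. real (len (d j)))) / real F"
      using F by (simp add: field_simps)
    also have "\<dots> = (\<Sum>j\<in>J. real (len (d j)) / real F) + real (card S) * M + (real (card S) + 1) * (1 / real F)"
      using F by (simp add: field_simps flip: sum_divide_distrib)
    finally show ?thesis .
  qed
  then have "cut_set_rates M N K (1 / real F) (\<lambda>d. real (len d) / real F)"
    unfolding cut_set_rates_def by simp
  with R show ?thesis by blast
qed

section \<open>Demands conditioned on the users requesting from a group\<close>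

lemma sum_iid_prod:
  fixes w :: "'a \<Rightarrow> real"
  assumes "finite X"
  shows "(\<Sum>f\<in>PiE {..<b::nat} (\<lambda>_. X). \<Prod>j<b. w (f j)) = (\<Sum>x\<in>X. w x) ^ b"
  using prod_sum_PiE[of "{..<b}" "\<lambda>_. X" "\<lambda>_. w"] assms by simp

lemma sum_iid_marginal:
  fixes w r :: "'a \<Rightarrow> real"
  assumes X: "finite X" and one: "(\<Sum>x\<in>X. w x) = 1" and i: "i < b"
  shows "(\<Sum>f\<in>PiE {..<b::nat} (\<lambda>_. X). (\<Prod>j<b. w (f j)) * r (f i)) = (\<Sum>x\<in>X. w x * r x)"
proof -
  \<comment> \<open>Writing the factor at \<open>i\<close> as a product with ones elsewhere lets the
    sum over tuples factor by coordinates; every coordinate but \<open>i\<close> contributes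
    1.\<close>
  have split: "(\<Prod>j<b. g j * (if j = i then h j else 1)) = (\<Prod>j<b. g j) * h i" for g h :: "nat \<Rightarrow> real"
    using i by (simp add: prod.distrib)
  have "(\<Sum>f\<in>PiE {..<b} (\<lambda>_. X). (\<Prod>j<b. w (f j)) * r (f i)) =
      (\<Sum>f\<in>PiE {..<b} (\<lambda>_. X). \<Prod>j<b. w (f j) * (if j = i then r (f j) else 1))"
    using split[of "\<lambda>j. w (f j)" "\<lambda>j. r (f j)" for f] by simp
  also have "\<dots> = (\<Prod>j<b. \<Sum>x\<in>X. w x * (if j = i then r x else 1))"
    using X by (subst prod_sum_PiE) auto
  also have "\<dots> = (\<Prod>j<b. if j = i then (\<Sum>x\<in>X. w x * r x) else 1)"
    using one by (intro prod.cong) auto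
  also have "\<dots> = (\<Sum>x\<in>X. w x * r x)" using i by simp
  finally show ?thesis .
qed

text \<open>Averages \<open>bound\<close> over \<open>b\<close> independent draws from
  \<open>w\<close>. An element \<open>i\<close> of \<open>G\<close> is missed by all draws with
  probability equal to the \<open>b\<close>-th power of missing it once, and each draw contributes
  the same mean of \<open>r\<close>.\<close>

lemma iid_union_bound:
  fixes w r :: "'a \<Rightarrow> real" and A :: "'a \<Rightarrow> 'b set"
  assumes X: "finite X" and w: "\<And>x. x \<in> X \<Longrightarrow> 0 \<le> w x" and one: "(\<Sum>x\<in>X. w x) = 1"
    and G: "finite G" "\<And>x. x \<in> X \<Longrightarrow> A x \<subseteq> G"
    and bound: "\<And>f. (\<And>j. j < b \<Longrightarrow> f j \<in> X) \<Longrightarrow> real (card (\<Union>j<b. A (f j))) - c \<le> (\<Sum>j<b. r (f j))"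
  shows "(\<Sum>i\<in>G. 1 - (\<Sum>x\<in>{x\<in>X. i \<notin> A x}. w x) ^ b) - c \<le> real b * (\<Sum>x\<in>X. w x * r x)"
proof -
  define Y where "Y = PiE {..<b} (\<lambda>_. X)"
  define \<mu> where "\<mu> f = (\<Prod>j<b. w (f j))" for f
  have \<mu>0: "0 \<le> \<mu> f" if "f \<in> Y" for f
    unfolding \<mu>_def by (rule prod_nonneg) (use that w in \<open>auto simp: Y_def\<close>)
  have \<mu>1: "(\<Sum>f\<in>Y. \<mu> f) = 1"
    unfolding Y_def \<mu>_def using sum_iid_prod[OF X] one by simp
  have finY: "finite Y" unfolding Y_def using X by (intro finite_PiE) auto
  \<comment> \<open>The event that \<open>i\<close> is missed becomes a product over the draws, so
    that its mean factors.\<close>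
  have card: "real (card (\<Union>j<b. A (f j))) = (\<Sum>i\<in>G. 1 - (\<Prod>j<b. of_bool (i \<notin> A (f j))))"
    if f: "f \<in> Y" for f
  proof -
    have "(\<Union>j<b. A (f j)) = G \<inter> {i. \<exists>j<b. i \<in> A (f j)}"
      using G(2) f unfolding Y_def by fastforce
    then have "real (card (\<Union>j<b. A (f j))) = (\<Sum>i\<in>G. of_bool (\<exists>j<b. i \<in> A (f j)))"
      using G(1) by simp
    also have "\<dots> = (\<Sum>i\<in>G. 1 - (\<Prod>j<b. of_bool (i \<notin> A (f j))))"
      by (intro sum.cong refl) (auto simp: prod_zero_iff)
    finally show ?thesis .
  qed
  have miss: "(\<Sum>f\<in>Y. \<mu> f * (\<Prod>j<b. of_bool (i \<notin> A (f j)))) = (\<Sum>x\<in>{x\<in>X. i \<notin> A x}. w x) ^ b" for i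
  proof -
    have "(\<Sum>f\<in>Y. \<mu> f * (\<Prod>j<b. of_bool (i \<notin> A (f j)))) = (\<Sum>f\<in>Y. \<Prod>j<b. w (f j) * of_bool (i \<notin> A (f j)))"
      by (simp add: \<mu>_def prod.distrib)
    also have "\<dots> = (\<Sum>x\<in>X. w x * of_bool (i \<notin> A x)) ^ b"
      unfolding Y_def by (rule sum_iid_prod[OF X])
    also have "(\<Sum>x\<in>X. w x * of_bool (i \<notin> A x)) = (\<Sum>x\<in>{x\<in>X. i \<notin> A x}. w x)"
      using X by (intro sum.mono_neutral_cong_right) auto
    finally show ?thesis .
  qed
  have "(\<Sum>i\<in>G. 1 - (\<Sum>x\<in>{x\<in>X. i \<notin> A x}. w x) ^ b)
      = (\<Sum>i\<in>G. \<Sum>f\<in>Y. \<mu> f * (1 - (\<Prod>j<b. of_bool (i \<notin> A (f j)))))"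
    by (intro sum.cong refl) (simp add: right_diff_distrib sum_subtractf \<mu>1 miss)
  also have "\<dots> = (\<Sum>f\<in>Y. \<mu> f * real (card (\<Union>j<b. A (f j))))"
    by (subst sum.swap) (simp add: card flip: sum_distrib_left)
  finally have "(\<Sum>i\<in>G. 1 - (\<Sum>x\<in>{x\<in>X. i \<notin> A x}. w x) ^ b) - c
      = (\<Sum>f\<in>Y. \<mu> f * (real (card (\<Union>j<b. A (f j))) - c))"
    using \<mu>1 by (simp add: right_diff_distrib sum_subtractf flip: sum_distrib_right)
  also have "\<dots> \<le> (\<Sum>f\<in>Y. \<mu> f * (\<Sum>j<b. r (f j)))"
    by (intro sum_mono mult_left_mono bound \<mu>0) (auto simp: Y_def)
  also have "\<dots> = (\<Sum>j<b. \<Sum>f\<in>Y. \<mu> f * r (f j))"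
    by (subst sum.swap) (simp add: sum_distrib_left)
  also have "\<dots> = real b * (\<Sum>x\<in>X. w x * r x)"
    unfolding Y_def \<mu>_def by (simp add: sum_iid_marginal[OF X one])
  finally show ?thesis .
qed

section \<open>Splitting the demands by the users that request from the group\<close>

text \<open>For \<open>T \<subseteq> {..<K}\<close> this is the event that \<open>T\<close> is
  exactly the set of users requesting from \<open>G\<close>. The product form makes weights factor
  over the users.\<close>

definition group_demands :: "nat \<Rightarrow> nat \<Rightarrow> nat set \<Rightarrow> nat set \<Rightarrow> (nat \<Rightarrow> nat) set" where
  "group_demands N K G T = PiE {..<K} (\<lambda>k. if k \<in> T then G else {1..N} - G)"

lemma finite_group_demands [simp]: "finite G \<Longrightarrow> finite (group_demands N K G T)"
  unfolding group_demands_def by (intro finite_PiE) auto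

lemma group_demands_subset: "G \<subseteq> {1..N} \<Longrightarrow> group_demands N K G T \<subseteq> demands N K"
  unfolding group_demands_def demands_def by (intro PiE_mono) auto

lemma demands_eq_UN_group_demands:
  assumes "G \<subseteq> {1..N}"
  shows "demands N K = (\<Union>T\<in>Pow {..<K}. group_demands N K G T)"
proof
  show "demands N K \<subseteq> (\<Union>T\<in>Pow {..<K}. group_demands N K G T)"
  proof
    fix d assume "d \<in> demands N K"
    then have "d \<in> group_demands N K G {k\<in>{..<K}. d k \<in> G}"
      unfolding group_demands_def demands_def by (auto simp: PiE_iff)
    then show "d \<in> (\<Union>T\<in>Pow {..<K}. group_demands N K G T)" by (rule UN_I[rotated]) auto
  qed
qed (rule UN_least, rule group_demands_subset[OF assms])

lemma group_demands_disjoint: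
  assumes "T \<subseteq> {..<K}" "T' \<subseteq> {..<K}" "T \<noteq> T'"
  shows "group_demands N K G T \<inter> group_demands N K G T' = {}"
proof (rule ccontr)
  assume "group_demands N K G T \<inter> group_demands N K G T' \<noteq> {}"
  then obtain d where d: "d \<in> group_demands N K G T" "d \<in> group_demands N K G T'" by blast
  have "T = {k\<in>{..<K}. d k \<in> G}" "T' = {k\<in>{..<K}. d k \<in> G}"
    using d assms unfolding group_demands_def by (fastforce simp: PiE_iff split: if_splits)+
  with assms show False by simp
qed

lemma sum_demands_eq:
  assumes G: "G \<subseteq> {1..N}"
  shows "(\<Sum>d\<in>demands N K. f d) = (\<Sum>T\<in>Pow {..<K}. \<Sum>d\<in>group_demands N K G T. f d)"
  unfolding demands_eq_UN_group_demands[OF G]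
proof (rule sum.UNION_disjoint)
  show "\<forall>T\<in>Pow {..<K}. finite (group_demands N K G T)"
    using finite_subset[OF G] by simp
  show "\<forall>T\<in>Pow {..<K}. \<forall>T'\<in>Pow {..<K}. T \<noteq> T' \<longrightarrow>
      group_demands N K G T \<inter> group_demands N K G T' = {}"
    using group_demands_disjoint by blast
qed simp

text \<open>Turns a sum over user sets into the sum that defines a binomial expectation.\<close>

lemma sum_Pow_card:
  fixes f :: "nat \<Rightarrow> real"
  shows "(\<Sum>T\<in>Pow {..<K::nat}. f (card T)) = (\<Sum>k\<le>K. real (K choose k) * f k)"
proof -
  have "(\<Sum>T\<in>Pow {..<K}. f (card T)) = (\<Sum>k\<le>K. \<Sum>T\<in>{T\<in>Pow {..<K}. card T = k}. f (card T))"
    by (rule sum.group[symmetric]) (auto intro: card_mono[of "{..<K}", simplified])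
  also have "\<dots> = (\<Sum>k\<le>K. real (K choose k) * f k)"
    using n_subsets[of "{..<K}"] by (intro sum.cong) auto
  finally show ?thesis .
qed

lemma sum_group_demands_prob:
  assumes T: "T \<subseteq> {..<K}" and G: "G \<subseteq> {1..N}" and p1: "(\<Sum>n\<in>{1..N}. p n) = 1"
  shows "(\<Sum>d\<in>group_demands N K G T. demand_prob p K d)
           = (\<Sum>n\<in>G. p n) ^ card T * (1 - (\<Sum>n\<in>G. p n)) ^ (K - card T)"
proof -
  have "(\<Sum>n\<in>{1..N} - G. p n) = 1 - (\<Sum>n\<in>G. p n)"
    using sum_diff[of "{1..N}" G p] G p1 by simp
  then have "(\<Sum>d\<in>group_demands N K G T. demand_prob p K d) =
      (\<Prod>k<K. if k \<in> T then (\<Sum>n\<in>G. p n) else 1 - (\<Sum>n\<in>G. p n))"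
    unfolding group_demands_def demand_prob_def
    using finite_subset[OF G] by (subst prod_sum_PiE[symmetric]) (auto intro!: prod.cong)
  also have "\<dots> = (\<Sum>n\<in>G. p n) ^ card T * (1 - (\<Sum>n\<in>G. p n)) ^ card ({..<K} - T)"
    using T by (simp add: prod.If_cases Int_absorb1 Diff_eq)
  finally show ?thesis
    using T by (simp add: card_Diff_subset finite_subset)
qed

text \<open>Given \<open>T\<close>, the demands are still independent, and a user in
  \<open>T\<close> requests \<open>i\<close> with probability
  \<open>p i / (\<Sum>n\<in>G. p n)\<close>.\<close>

lemma sum_group_demands_prob_avoid:
  assumes T: "T \<subseteq> {..<K}" and S: "S \<subseteq> T" and G: "G \<subseteq> {1..N}" and p1: "(\<Sum>n\<in>{1..N}. p n) = 1"
    and i: "i \<in> G" and P: "(\<Sum>n\<in>G. p n) > 0"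
  shows "(\<Sum>d\<in>{d\<in>group_demands N K G T. i \<notin> d ` S}. demand_prob p K d)
           = (1 - p i / (\<Sum>n\<in>G. p n)) ^ card S * (\<Sum>d\<in>group_demands N K G T. demand_prob p K d)"
proof -
  define P where "P = (\<Sum>n\<in>G. p n)"
  have finG: "finite G" using G finite_subset by blast
  let ?A = "\<lambda>k. if k \<in> T then G else {1..N} - G"
  let ?B = "\<lambda>k. if k \<in> S then G - {i} else ?A k"
  have B: "x \<in> ?B k \<longleftrightarrow> x \<in> ?A k \<and> (k \<in> S \<longrightarrow> x \<noteq> i)" for k x
    using S by auto
  \<comment> \<open>Avoiding \<open>i\<close> on \<open>S\<close> is a constraint on each user
    separately, so the restricted event is again a product set.\<close>
  have "d \<in> PiE {..<K} ?B \<longleftrightarrow> d \<in> PiE {..<K} ?A \<and> i \<notin> d ` S" for d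
    unfolding PiE_iff B ball_conj_distrib using S T by blast
  then have "{d\<in>group_demands N K G T. i \<notin> d ` S} = PiE {..<K} ?B"
    unfolding group_demands_def by blast
  then have "(\<Sum>d\<in>{d\<in>group_demands N K G T. i \<notin> d ` S}. demand_prob p K d)
      = (\<Prod>k<K. \<Sum>n\<in>?B k. p n)"
    unfolding demand_prob_def using finG by (subst prod_sum_PiE) auto
  also have "\<dots> = (\<Prod>k<K. (if k \<in> S then 1 - p i / P else 1) * (\<Sum>n\<in>(if k \<in> T then G else {1..N} - G). p n))"
  proof (rule prod.cong[OF refl])
    fix k
    have "(\<Sum>n\<in>G - {i}. p n) = (1 - p i / P) * P"
      using finG i P by (simp add: sum_diff1 P_def field_simps)
    then show "(\<Sum>n\<in>?B k. p n) = (if k \<in> S then 1 - p i / P else 1) * (\<Sum>n\<in>(if k \<in> T then G else {1..N} - G). p n)"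
      using S by (auto simp: P_def)
  qed
  also have "\<dots> = (1 - p i / P) ^ card S * (\<Prod>k<K. \<Sum>n\<in>(if k \<in> T then G else {1..N} - G). p n)"
    using S T by (simp add: prod.distrib prod.If_cases Int_absorb1)
  also have "(\<Prod>k<K. \<Sum>n\<in>(if k \<in> T then G else {1..N} - G). p n) = (\<Sum>d\<in>group_demands N K G T. demand_prob p K d)"
    unfolding demand_prob_def group_demands_def using finG by (subst prod_sum_PiE) auto
  finally show ?thesis unfolding P_def .
qed

section \<open>Two rate bounds given the set of users requesting from the group\<close>

text \<open>Draws \<open>b\<close> independent demand vectors conditioned on \<open>T\<close> and
  applies the cut-set bound to \<open>s\<close> users of \<open>T\<close>. By \<open>unif\<close>
  each of the \<open>s * b\<close> demands hits a given file of \<open>G\<close> with probability at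
  least \<open>1 / (2 * card G)\<close>, which bounds the expected number of distinct files from
  below.\<close>

lemma group_rate_many_users:
  assumes r: "cut_set_rates M N K \<delta> r" and T: "T \<subseteq> {..<K}" and G: "G \<subseteq> {1..N}"
    and p0: "\<And>n. n \<in> {1..N} \<Longrightarrow> 0 \<le> p n" and p1: "(\<Sum>n\<in>{1..N}. p n) = 1"
    and P: "(\<Sum>n\<in>G. p n) > 0"
    and unif: "\<And>i. i \<in> G \<Longrightarrow> (\<Sum>n\<in>G. p n) \<le> 2 * real (card G) * p i"
    and s: "s \<le> card T" and b: "b \<le> card G"
  shows "(\<Sum>d\<in>group_demands N K G T. demand_prob p K d) *
           (real (card G) * (1 - (1 - 1 / (2 * real (card G))) ^ (s * b)) - real s * M - (real s + 1) * \<delta>)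
         \<le> real b * (\<Sum>d\<in>group_demands N K G T. demand_prob p K d * r d)"
proof -
  define n where "n = real (card G)"
  define X where "X = group_demands N K G T"
  define \<pi> where "\<pi> = (\<Sum>d\<in>X. demand_prob p K d)"
  have finG: "finite G" using G finite_subset by blast
  have XD: "X \<subseteq> demands N K" unfolding X_def by (rule group_demands_subset[OF G])
  have finX: "finite X" using XD finite_demands finite_subset by blast
  have r0: "0 \<le> r d" if "d \<in> X" for d using r XD that unfolding cut_set_rates_def by blast
  have w0: "0 \<le> demand_prob p K d" if "d \<in> X" for d
    by (rule demand_prob_nonneg[OF p0 subsetD[OF XD that]])
  have \<pi>0: "0 \<le> \<pi>" unfolding \<pi>_def by (rule sum_nonneg) (rule w0)
  have bN: "b \<le> N" using b card_mono[OF _ G] by simp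
  have "G \<noteq> {}" using P by auto
  then have n: "n \<ge> 1" unfolding n_def using finG by (simp add: Suc_le_eq card_gt_0_iff)
  obtain S where S: "S \<subseteq> T" "card S = s" using s by (metis obtain_subset_with_card_n)
  show ?thesis
  \<comment> \<open>Conditioning needs positive probability; otherwise the left side is 0.\<close>
  proof (cases "\<pi> = 0")
    case True
    then show ?thesis
      using r0 w0 by (simp add: \<pi>_def X_def sum_nonneg)
  next
    case False
    then have \<pi>: "\<pi> > 0" using \<pi>0 by simp
    define c where "c = real s * M + (real s + 1) * \<delta>"
    define w where "w d = demand_prob p K d / \<pi>" for d
    have key: "(\<Sum>i\<in>G. 1 - (\<Sum>x\<in>{x\<in>X. i \<notin> x ` S}. w x) ^ b) - c \<le> real b * (\<Sum>x\<in>X. w x * r x)"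
    proof (rule iid_union_bound[where A = "\<lambda>x. x ` S"])
      show "sum w X = 1" unfolding w_def using \<pi> by (simp add: \<pi>_def flip: sum_divide_distrib)
      show "0 \<le> w x" if "x \<in> X" for x unfolding w_def using w0[OF that] \<pi> by simp
      show "x ` S \<subseteq> G" if "x \<in> X" for x
      proof
        fix y assume "y \<in> x ` S"
        then obtain k where k: "k \<in> S" "y = x k" by blast
        then have "k \<in> {..<K}" "k \<in> T" using S T by auto
        moreover have "x k \<in> (if k \<in> T then G else {1..N} - G)"
          using that \<open>k \<in> {..<K}\<close> unfolding X_def group_demands_def by (rule PiE_mem)
        ultimately show "y \<in> G" using k by simp
      qed
      show "real (card (\<Union>j<b. f j ` S)) - c \<le> (\<Sum>j<b. r (f j))"
        if "\<And>j. j < b \<Longrightarrow> f j \<in> X" for f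
      proof -
        have "\<forall>j\<in>{..<b}. f j \<in> demands N K" using that XD by auto
        moreover have "finite {..<b}" "card {..<b} \<le> N" "S \<subseteq> {..<K}" using bN S T by auto
        ultimately have "real (card (\<Union>j<b. f j ` S)) \<le> (\<Sum>j<b. r (f j)) + real (card S) * M + (real (card S) + 1) * \<delta>"
          using r unfolding cut_set_rates_def by blast
        then show ?thesis using S by (simp add: c_def)
      qed
    qed (use finX finG in auto)
    have miss: "(\<Sum>x\<in>{x\<in>X. i \<notin> x ` S}. w x) ^ b \<le> (1 - 1 / (2 * n)) ^ (s * b)" if i: "i \<in> G" for i
    proof -
      have "(\<Sum>x\<in>{x\<in>X. i \<notin> x ` S}. w x) = (1 - p i / (\<Sum>n\<in>G. p n)) ^ s"
        using sum_group_demands_prob_avoid[OF T S(1) G p1 i P] \<pi> S(2)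
        by (simp add: w_def X_def \<pi>_def flip: sum_divide_distrib)
      moreover have "1 / (2 * n) \<le> p i / (\<Sum>n\<in>G. p n)"
        using unif[OF i] P n by (simp add: n_def field_simps)
      moreover have "p i \<le> (\<Sum>n\<in>G. p n)"
        by (rule member_le_sum[OF i]) (use p0 G finG in auto)
      then have "p i / (\<Sum>n\<in>G. p n) \<le> 1" using P by simp
      ultimately show ?thesis
        unfolding power_mult by (intro power_mono) (auto intro!: power_mono)
    qed
    have "n * (1 - (1 - 1 / (2 * n)) ^ (s * b)) - c = (\<Sum>i\<in>G. 1 - (1 - 1 / (2 * n)) ^ (s * b)) - c"
      by (simp add: n_def)
    also have "\<dots> \<le> (\<Sum>i\<in>G. 1 - (\<Sum>x\<in>{x\<in>X. i \<notin> x ` S}. w x) ^ b) - c"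
      using miss by (intro diff_right_mono sum_mono) auto
    also have "\<dots> \<le> real b * (\<Sum>x\<in>X. w x * r x)" by (rule key)
    also have "(\<Sum>x\<in>X. w x * r x) = (\<Sum>x\<in>X. demand_prob p K x * r x) / \<pi>"
      by (simp add: w_def sum_divide_distrib)
    finally have "\<pi> * (n * (1 - (1 - 1 / (2 * n)) ^ (s * b)) - c) \<le> real b * (\<Sum>x\<in>X. demand_prob p K x * r x)"
      using \<pi> by (simp add: pos_le_divide_eq mult.commute)
    then show ?thesis unfolding n_def X_def \<pi>_def c_def by (simp add: algebra_simps)
  qed
qed

text \<open>The demands of all other users stay fixed while \<open>k0\<close> runs through
  \<open>G\<close>: one cache and \<open>card G\<close> messages reveal the whole group. This keeps
  the factor \<open>card G - M\<close>, which is needed when \<open>M\<close> is close to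
  \<open>card G\<close>.\<close>

lemma group_rate_single_user:
  assumes r: "cut_set_rates M N K \<delta> r" and T: "T \<subseteq> {..<K}" and G: "G \<subseteq> {1..N}"
    and p0: "\<And>n. n \<in> {1..N} \<Longrightarrow> 0 \<le> p n" and P: "(\<Sum>n\<in>G. p n) > 0"
    and unif: "\<And>i. i \<in> G \<Longrightarrow> (\<Sum>n\<in>G. p n) \<le> 2 * real (card G) * p i"
    and k0: "k0 \<in> T"
  shows "(\<Sum>d\<in>group_demands N K G T. demand_prob p K d) * ((real (card G) - M - 2 * \<delta>) / (2 * real (card G)))
         \<le> (\<Sum>d\<in>group_demands N K G T. demand_prob p K d * r d)"
proof -
  define n where "n = real (card G)"
  define P where "P = (\<Sum>n\<in>G. p n)"
  define B where "B k = (if k \<in> T then G else {1..N} - G)" for k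
  define Y where "Y = PiE ({..<K} - {k0}) B"
  define w where "w e = (\<Prod>k\<in>{..<K} - {k0}. p (e k))" for e
  have finG: "finite G" using G finite_subset by blast
  have "G \<noteq> {}" using P by auto
  then have n: "n \<ge> 1" unfolding n_def using finG by (simp add: Suc_le_eq card_gt_0_iff)
  have k0K: "k0 < K" using k0 T by auto
  then have ins: "{..<K} = insert k0 ({..<K} - {k0})" by auto
  have Bk0: "B k0 = G" using k0 by (simp add: B_def)
  \<comment> \<open>A demand vector splits into the demand \<open>i\<close> of \<open>k0\<close> and
    the demands \<open>e\<close> of the others.\<close>
  have X: "group_demands N K G T = (\<lambda>(i, e). e(k0 := i)) ` (G \<times> Y)"
    unfolding group_demands_def Y_def using PiE_insert_eq[of k0 "{..<K} - {k0}" B] ins Bk0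
    by (simp add: B_def[abs_def])
  have inj: "inj_on (\<lambda>(i, e). e(k0 := i)) (G \<times> Y)"
    unfolding Y_def using inj_combinator[of k0 "{..<K} - {k0}" B] Bk0 by simp
  have dem: "demand_prob p K (e(k0 := i)) = p i * w e" for e i
  proof -
    have "demand_prob p K (e(k0 := i)) = p i * (\<Prod>k\<in>{..<K} - {k0}. p ((e(k0 := i)) k))"
      unfolding demand_prob_def using k0K by (subst prod.remove[of _ k0]) auto
    also have "(\<Prod>k\<in>{..<K} - {k0}. p ((e(k0 := i)) k)) = w e"
      unfolding w_def by (intro prod.cong) auto
    finally show ?thesis .
  qed
  have split: "(\<Sum>d\<in>group_demands N K G T. demand_prob p K d * f d) = (\<Sum>e\<in>Y. w e * (\<Sum>i\<in>G. p i * f (e(k0 := i))))" for f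
  proof -
    have "(\<Sum>d\<in>group_demands N K G T. demand_prob p K d * f d)
        = (\<Sum>(i, e)\<in>G \<times> Y. p i * w e * f (e(k0 := i)))"
      unfolding X by (subst sum.reindex[OF inj]) (simp add: dem case_prod_unfold)
    also have "\<dots> = (\<Sum>e\<in>Y. \<Sum>i\<in>G. p i * w e * f (e(k0 := i)))"
      by (simp add: sum.swap[of _ Y] flip: sum.cartesian_product)
    also have "\<dots> = (\<Sum>e\<in>Y. w e * (\<Sum>i\<in>G. p i * f (e(k0 := i))))"
      by (simp add: sum_distrib_left mult_ac)
    finally show ?thesis .
  qed
  have total: "(\<Sum>d\<in>group_demands N K G T. demand_prob p K d) = (\<Sum>e\<in>Y. w e * P)"
    using split[of "\<lambda>_. 1"] by (simp add: P_def)
  have each: "w e * P * ((n - M - 2 * \<delta>) / (2 * n)) \<le> w e * (\<Sum>i\<in>G. p i * r (e(k0 := i)))"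
    if e: "e \<in> Y" for e
  proof -
    have BN: "B k \<subseteq> {1..N}" for k using G by (auto simp: B_def)
    have "p (e k) \<ge> 0" if "k \<in> {..<K} - {k0}" for k
    proof (rule p0)
      have "e k \<in> B k" using e that unfolding Y_def by (rule PiE_mem)
      then show "e k \<in> {1..N}" using BN by blast
    qed
    then have w0: "0 \<le> w e" unfolding w_def by (rule prod_nonneg)
    have eD: "e(k0 := i) \<in> demands N K" if "i \<in> G" for i
      using group_demands_subset[OF G, of K T] X e that by auto
    have r0: "0 \<le> r (e(k0 := i))" if "i \<in> G" for i
      using r eD[OF that] unfolding cut_set_rates_def by blast
    have "\<forall>i\<in>G. e(k0 := i) \<in> demands N K" "card G \<le> N" "{k0} \<subseteq> {..<K}"
      using eD card_mono[OF _ G] k0K by auto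
    with r finG have "real (card (\<Union>i\<in>G. (e(k0 := i)) ` {k0}))
        \<le> (\<Sum>i\<in>G. r (e(k0 := i))) + real (card {k0}) * M + (real (card {k0}) + 1) * \<delta>"
      unfolding cut_set_rates_def by blast
    then have "n - M - 2 * \<delta> \<le> (\<Sum>i\<in>G. r (e(k0 := i)))" by (simp add: n_def)
    \<comment> \<open>By \<open>unif\<close>, \<open>P / (2 * n)\<close> is at most every
      \<open>p i\<close>; since rates are nonnegative, the uniform weight can then be raised to
      \<open>p i\<close>.\<close>
    then have "P / (2 * n) * (n - M - 2 * \<delta>) \<le> P / (2 * n) * (\<Sum>i\<in>G. r (e(k0 := i)))"
      using \<open>(\<Sum>n\<in>G. p n) > 0\<close> n by (intro mult_left_mono) (auto simp: P_def)
    also have "\<dots> = (\<Sum>i\<in>G. P / (2 * n) * r (e(k0 := i)))" by (rule sum_distrib_left)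
    also have "\<dots> \<le> (\<Sum>i\<in>G. p i * r (e(k0 := i)))"
      using unif n by (intro sum_mono mult_right_mono r0) (auto simp: P_def n_def field_simps)
    finally have "w e * (P / (2 * n) * (n - M - 2 * \<delta>)) \<le> w e * (\<Sum>i\<in>G. p i * r (e(k0 := i)))"
      using w0 by (rule mult_left_mono)
    then show ?thesis by (simp add: mult_ac)
  qed
  have "(\<Sum>d\<in>group_demands N K G T. demand_prob p K d) * ((n - M - 2 * \<delta>) / (2 * n))
      = (\<Sum>e\<in>Y. w e * P * ((n - M - 2 * \<delta>) / (2 * n)))"
    unfolding total by (rule sum_distrib_right)
  also have "\<dots> \<le> (\<Sum>d\<in>group_demands N K G T. demand_prob p K d * r d)"
    unfolding split by (intro sum_mono each)
  finally show ?thesis unfolding n_def .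
qed

section \<open>Comparing the cut-set bounds with \<open>Rfun\<close>\<close>

text \<open>The first bound is Bernoulli's inequality, the second keeps only the other argument of
  \<open>min\<close>, and the third drops the power but keeps the factor
  \<open>1 - M / n\<close>.\<close>

lemma Rfun_le:
  assumes M: "0 \<le> M" "M \<le> real n" and n: "n \<ge> 1"
  shows "Rfun M n k \<le> real k" "Rfun M n k \<le> real n" "M > 0 \<Longrightarrow> Rfun M n k \<le> real n / M - 1"
proof -
  define y where "y = M / real n"
  have y: "0 \<le> y" "y \<le> 1" unfolding y_def using M n by (auto simp: field_simps)
  show "M > 0 \<Longrightarrow> Rfun M n k \<le> real n / M - 1"
  proof -
    assume M0: "M > 0"
    have "Rfun M n k = (1 - y) * min (real n / M * (1 - (1 - y) ^ k)) (real n)"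
      using M0 M by (simp add: Rfun_def y_def)
    also have "\<dots> \<le> (1 - y) * (real n / M * 1)"
      using y M0 by (intro mult_left_mono min.coboundedI1) auto
    also have "\<dots> = real n / M - 1"
      using M0 n by (simp add: y_def field_simps)
    finally show ?thesis .
  qed
  show "Rfun M n k \<le> real k"
  proof (cases "M = 0")
    case False
    then have M0: "M > 0" using M by simp
    have bern: "1 - real k * y \<le> (1 - y) ^ k"
      using Bernoulli_inequality[of "- y" k] y by simp
    have "Rfun M n k = (1 - y) * min (real n / M * (1 - (1 - y) ^ k)) (real n)"
      using M0 M by (simp add: Rfun_def y_def)
    also have "\<dots> \<le> 1 * min (real n / M * (1 - (1 - y) ^ k)) (real n)"
      using y M0 by (intro mult_right_mono) (auto simp: power_le_one)
    also have "\<dots> \<le> real n / M * (real k * y)"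
      using bern M0 by (simp add: min_le_iff_disj divide_right_mono mult_left_mono)
    also have "\<dots> = real k" using M0 n by (simp add: y_def)
    finally show ?thesis .
  qed (simp add: Rfun_def)
  show "Rfun M n k \<le> real n"
  proof (cases "M = 0")
    case False
    then have M0: "M > 0" using M by simp
    have "Rfun M n k = (1 - y) * min (real n / M * (1 - (1 - y) ^ k)) (real n)"
      using M0 M by (simp add: Rfun_def y_def)
    also have "\<dots> \<le> 1 * real n"
      using y M0 by (intro mult_mono) (auto simp: power_le_one)
    finally show ?thesis by simp
  qed (simp add: Rfun_def)
qed

lemma one_minus_power_lower:
  fixes y :: real
  assumes "0 \<le> y" "y \<le> 1" "real m * y \<le> 1/2"
  shows "2/3 * (real m * y) \<le> 1 - (1 - y) ^ m"
proof -
  \<comment> \<open>Bernoulli gives \<open>(1 - y) ^ m \<le> 1 / (1 + m y)\<close>.\<close>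
  have "(1 - y) ^ m * (1 + real m * y) \<le> (1 - y) ^ m * (1 + y) ^ m"
    using Bernoulli_inequality[of y m] assms by (intro mult_left_mono) auto
  also have "\<dots> = (1 - y\<^sup>2) ^ m"
    by (simp add: power2_eq_square algebra_simps flip: power_mult_distrib)
  also have "\<dots> \<le> 1" using assms by (intro power_le_one) (auto simp: power_le_one)
  finally have "(1 - y) ^ m * (1 + real m * y) \<le> 1" .
  \<comment> \<open>With \<open>t = m * y\<close> the right side equals
    \<open>1 + 2/3 * t * (1/2 - t)\<close>; the constant 2/3 makes this exactly 1 at
    \<open>t = 1/2\<close>.\<close>
  moreover have "1 \<le> (1 - 2/3 * (real m * y)) * (1 + real m * y)"
  proof -
    have "0 \<le> (real m * y) * (1/2 - real m * y)" using assms by (intro mult_nonneg_nonneg) auto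
    then show ?thesis by (simp add: algebra_simps)
  qed
  ultimately have "(1 - y) ^ m * (1 + real m * y) \<le> (1 - 2/3 * (real m * y)) * (1 + real m * y)"
    by linarith
  then have "(1 - y) ^ m \<le> 1 - 2/3 * (real m * y)"
    by (rule mult_right_le_imp_le) (use assms in \<open>auto intro: add_pos_nonneg\<close>)
  then show ?thesis by linarith
qed

text \<open>The choice is \<open>s\<close> of order \<open>min k (n / M)\<close>, so that the caches of \<open>s\<close> users hold only a small
  fraction of the group, and \<open>b\<close> of order \<open>n / s\<close>, so that the \<open>s * b\<close> demands still hit a number of
  distinct files proportional to \<open>s * b\<close>.\<close>

lemma Rfun_le_cut_set:
  assumes M: "0 \<le> M" "16 * M \<le> real n" and n: "n \<ge> 1" and k: "k \<ge> 1"
  shows "\<exists>s b. s \<le> k \<and> 1 \<le> b \<and> b \<le> n \<and>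
    real b * Rfun M n k \<le> 160 * (real n * (1 - (1 - 1 / (2 * real n)) ^ (s * b)) - real s * M)"
proof -
  \<comment> \<open>The value \<open>M = 0\<close> is treated apart because
    \<open>n / (16 * M)\<close> would then evaluate to 0.\<close>
  define x where "x = (if M = 0 then real n else min (real n) (real n / (16 * M)))"
  define f where "f = nat \<lfloor>x\<rfloor>"
  define s where "s = min k f"
  define b where "b = n div s"
  define g where "g = real n * (1 - (1 - 1 / (2 * real n)) ^ (s * b))"
  have x1: "x \<ge> 1" using M n by (auto simp: x_def min_def field_simps)
  have xn: "x \<le> real n" by (auto simp: x_def)
  have xM: "x * (16 * M) \<le> real n"
  proof (cases "M = 0")
    case False
    then have "M > 0" using M by simp
    moreover have "x \<le> real n / (16 * M)" using False by (simp add: x_def)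
    ultimately show ?thesis by (simp add: field_simps)
  qed (use n in simp)
  have fx: "real f \<le> x" unfolding f_def using x1 by simp
  have f1: "f \<ge> 1" unfolding f_def using x1 by (simp add: le_nat_floor)
  \<comment> \<open>As \<open>f\<close> is at least 1, rounding down costs at most a factor of two;
    with the factor 16 of \<open>R16\<close> this gives the 32 in \<open>R\<close>.\<close>
  have "x < real f + 1" unfolding f_def using x1 by linarith
  then have xf: "x \<le> 2 * real f" using f1 by linarith
  have s1: "s \<ge> 1" using f1 k by (simp add: s_def)
  have "real s \<le> x" using fx by (simp add: s_def)
  then have sn: "s \<le> n" using xn by linarith
  have sM: "real s * M \<le> real n / 16"
    using mult_right_mono[OF \<open>real s \<le> x\<close> M(1)] xM by linarith
  have R16: "Rfun M n k \<le> 16 * x"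
  proof (cases "M = 0")
    case True then show ?thesis using Rfun_le(2)[of M n k] M n by (simp add: x_def)
  next
    case False
    then have "M > 0" using M by simp
    then have "Rfun M n k \<le> real n / M - 1" using Rfun_le(3)[of M n k] M n by simp
    moreover have "Rfun M n k \<le> real n" using Rfun_le(2)[of M n k] M n by simp
    ultimately show ?thesis using False by (auto simp: x_def min_def)
  qed
  have Rk: "Rfun M n k \<le> real k" using Rfun_le(1)[of M n k] M n by simp
  have R: "Rfun M n k \<le> 32 * real s"
    using R16 Rk xf by (auto simp: s_def min_def)
  have b1: "b \<ge> 1" unfolding b_def using sn s1 by (simp add: div_greater_zero_iff Suc_le_eq)
  have bn: "b \<le> n" unfolding b_def by simp
  have sbn: "s * b \<le> n" unfolding b_def by simp
  have "n < s * (b + 1)" unfolding b_def using s1 by (simp add: dividend_less_times_div)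
  also have "\<dots> \<le> s * (2 * b)" using b1 by (intro mult_left_mono) auto
  finally have n2: "real n \<le> 2 * (real s * real b)"
    by (metis (no_types, lifting) less_imp_le_nat mult.left_commute of_nat_le_iff of_nat_mult of_nat_numeral)
  have sb0: "0 \<le> real s * real b" by simp
  have sbn': "real s * real b \<le> real n" using sbn by (metis of_nat_le_iff of_nat_mult)
  \<comment> \<open>Since \<open>s * b \<le> n\<close>, the exponent times
    \<open>1 / (2 * n)\<close> is at most 1/2, as the lemma demands.\<close>
  have "2/3 * (real (s * b) * (1 / (2 * real n))) \<le> 1 - (1 - 1 / (2 * real n)) ^ (s * b)"
    by (rule one_minus_power_lower) (use n sbn' in \<open>auto simp: field_simps\<close>)
  then have "real n * (2/3 * (real (s * b) * (1 / (2 * real n)))) \<le> real n * (1 - (1 - 1 / (2 * real n)) ^ (s * b))"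
    by (intro mult_left_mono) auto
  then have g: "real s * real b / 3 \<le> g"
    using n by (simp add: g_def mult_ac)
  have "real b * Rfun M n k \<le> real b * (32 * real s)" using R by (intro mult_left_mono) auto
  also have "\<dots> = 32 * (real s * real b)" by simp
  \<comment> \<open>With \<open>t = s * b\<close>: \<open>g \<ge> t / 3\<close> and
    \<open>s * M \<le> n / 16 \<le> t / 8\<close>, so the difference is at least
    \<open>5 * t / 24\<close>, and \<open>160 * 5 / 24\<close> exceeds 32.\<close>
  also have "\<dots> \<le> 160 * (g - real s * M)"
  proof -
    have "32 * t \<le> 160 * (u - v)" if "t / 3 \<le> u" "v \<le> x / 16" "x \<le> 2 * t" "0 \<le> t" for t u v x :: real
      using that by (simp add: field_simps)
    then show ?thesis using g sM n2 sb0 by blast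
  qed
  finally have "real b * Rfun M n k \<le> 160 * (real n * (1 - (1 - 1 / (2 * real n)) ^ (s * b)) - real s * M)"
    unfolding g_def .
  then show ?thesis using b1 bn by (intro exI[of _ s] exI[of _ b]) (auto simp: s_def)
qed

section \<open>The lower bound\<close>

text \<open>Joins the two rate bounds: one user suffices once \<open>M\<close> exceeds a sixteenth
  of the group size, many users serve below that, and in the remaining cases \<open>Rfun\<close>
  vanishes.\<close>

lemma group_rate:
  assumes r: "cut_set_rates M N K \<delta> r" and T: "T \<subseteq> {..<K}" and G: "G \<subseteq> {1..N}"
    and p0: "\<And>n. n \<in> {1..N} \<Longrightarrow> 0 \<le> p n" and p1: "(\<Sum>n\<in>{1..N}. p n) = 1"
    and P: "(\<Sum>n\<in>G. p n) > 0"
    and unif: "\<And>i. i \<in> G \<Longrightarrow> (\<Sum>n\<in>G. p n) \<le> 2 * real (card G) * p i"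
    and M: "0 \<le> M" and \<delta>: "0 \<le> \<delta>"
  shows "(\<Sum>d\<in>group_demands N K G T. demand_prob p K d) *
           (Rfun M (card G) (card T) / 160 - (real K + 1) * \<delta>)
         \<le> (\<Sum>d\<in>group_demands N K G T. demand_prob p K d * r d)"
proof -
  define n where "n = card G"
  define k where "k = card T"
  define X where "X = group_demands N K G T"
  define \<pi> where "\<pi> = (\<Sum>d\<in>X. demand_prob p K d)"
  define \<rho> where "\<rho> = (\<Sum>d\<in>X. demand_prob p K d * r d)"
  have finG: "finite G" using G finite_subset by blast
  have "G \<noteq> {}" using P by auto
  then have n: "n \<ge> 1" unfolding n_def using finG by (simp add: Suc_le_eq card_gt_0_iff)
  have kK: "k \<le> K" using card_mono[OF _ T] by (simp add: k_def)
  have XD: "X \<subseteq> demands N K" unfolding X_def by (rule group_demands_subset[OF G])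
  have r0: "0 \<le> r d" if "d \<in> X" for d using r XD that unfolding cut_set_rates_def by blast
  have w0: "0 \<le> demand_prob p K d" if "d \<in> X" for d
    by (rule demand_prob_nonneg[OF p0 subsetD[OF XD that]])
  have \<pi>0: "0 \<le> \<pi>" unfolding \<pi>_def by (rule sum_nonneg) (rule w0)
  have \<rho>0: "0 \<le> \<rho>" unfolding \<rho>_def by (intro sum_nonneg mult_nonneg_nonneg r0 w0)
  have "\<pi> * (Rfun M n k / 160 - (real K + 1) * \<delta>) \<le> \<rho>"
  proof -
    consider "k = 0 \<or> M > real n" | "k \<ge> 1" "M \<le> real n" "16 * M > real n" | "k \<ge> 1" "16 * M \<le> real n"
      by linarith
    then show ?thesis
    proof cases
      case 1
      then have "Rfun M n k = 0" using M by (auto simp: Rfun_def)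
      then have "\<pi> * (Rfun M n k / 160 - (real K + 1) * \<delta>) \<le> 0"
        using \<pi>0 \<delta> by (simp add: mult_nonneg_nonneg)
      then show ?thesis using \<rho>0 by linarith
    next
      case 2
      then have M0: "M > 0" using n by linarith
      obtain k0 where "k0 \<in> T" using 2(1) unfolding k_def by fastforce
      then have "\<pi> * ((real n - M - 2 * \<delta>) / (2 * real n)) \<le> \<rho>"
        using group_rate_single_user[OF r T G p0 P unif] unfolding \<pi>_def \<rho>_def X_def n_def by blast
      moreover have "Rfun M n k / 160 - (real K + 1) * \<delta> \<le> (real n - M - 2 * \<delta>) / (2 * real n)"
      proof -
        have "Rfun M n k \<le> real n / M - 1" using Rfun_le(3)[of M n k] M M0 2 n by simp
        also have "\<dots> = (real n - M) / M" using M0 by (simp add: field_simps)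
        \<comment> \<open>Here \<open>M > n / 16\<close> enters: the caching gain
          \<open>n / M\<close> is bounded by a constant.\<close>
        also have "\<dots> \<le> (real n - M) / (real n / 16)"
          using 2 M0 n by (intro divide_left_mono) auto
        also have "\<dots> = 32 * ((real n - M) / (2 * real n))" using n by (simp add: field_simps)
        finally have "Rfun M n k / 160 \<le> (real n - M) / (2 * real n)"
          using 2 n by (simp add: field_simps)
        moreover have "2 * \<delta> / (2 * real n) \<le> (real K + 1) * \<delta>"
        proof -
          have "2 * \<delta> / (2 * real n) \<le> \<delta>" using n \<delta> by (simp add: divide_le_eq mult_left_le mult_le_cancel_left1)
          also have "\<dots> \<le> (real K + 1) * \<delta>" using \<delta> by (simp add: algebra_simps)
          finally show ?thesis .
        qed
        ultimately show ?thesis by (simp add: diff_divide_distrib)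
      qed
      ultimately show ?thesis using \<pi>0 by (meson mult_left_mono order_trans)
    next
      case 3
      then obtain s b where sb: "s \<le> k" "1 \<le> b" "b \<le> n" and
        R: "real b * Rfun M n k \<le> 160 * (real n * (1 - (1 - 1 / (2 * real n)) ^ (s * b)) - real s * M)"
        using Rfun_le_cut_set[of M n k] M n by blast
      define g where "g = real n * (1 - (1 - 1 / (2 * real n)) ^ (s * b)) - real s * M"
      have "\<pi> * (g - (real s + 1) * \<delta>) \<le> real b * \<rho>"
        using group_rate_many_users[OF r T G p0 p1 P unif, of s b] sb
        unfolding \<pi>_def \<rho>_def X_def n_def g_def k_def by simp
      moreover have "real b * (Rfun M n k / 160 - (real K + 1) * \<delta>) \<le> g - (real s + 1) * \<delta>"
      proof -
        have "(real s + 1) * \<delta> \<le> (real K + 1) * \<delta>"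
          using sb kK \<delta> by (intro mult_right_mono) auto
        also have "\<dots> = 1 * ((real K + 1) * \<delta>)" by simp
        also have "\<dots> \<le> real b * ((real K + 1) * \<delta>)"
          using sb \<delta> by (intro mult_right_mono) auto
        finally have "(real s + 1) * \<delta> \<le> real b * ((real K + 1) * \<delta>)" .
        moreover have "real b * Rfun M n k / 160 \<le> g" using R unfolding g_def[symmetric] by simp
        ultimately show ?thesis by (simp add: right_diff_distrib)
      qed
      ultimately have "\<pi> * (real b * (Rfun M n k / 160 - (real K + 1) * \<delta>)) \<le> real b * \<rho>"
        using \<pi>0 by (meson mult_left_mono order_trans)
      then have "real b * (\<pi> * (Rfun M n k / 160 - (real K + 1) * \<delta>)) \<le> real b * \<rho>"
        by (simp only: mult.left_commute)
      then show ?thesis using sb by (simp add: mult_le_cancel_left)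
    qed
  qed
  then show ?thesis unfolding \<pi>_def \<rho>_def X_def n_def k_def .
qed

lemma sum_demand_prob:
  assumes "(\<Sum>n\<in>{1..N}. p n) = 1"
  shows "(\<Sum>d\<in>demands N K. demand_prob p K d) = 1"
  unfolding demands_def demand_prob_def
  using assms by (subst prod_sum_PiE[symmetric]) auto

text \<open>Sums the bound over all \<open>T\<close>. The event of \<open>T\<close> has a
  probability depending only on \<open>card T\<close>, so the left side becomes a binomial
  expectation; these probabilities add up to 1, so the \<open>\<delta>\<close> term survives only
  once.\<close>

lemma expected_group_rate:
  assumes r: "cut_set_rates M N K \<delta> r" and G: "G \<subseteq> {1..N}"
    and p0: "\<And>n. n \<in> {1..N} \<Longrightarrow> 0 \<le> p n" and p1: "(\<Sum>n\<in>{1..N}. p n) = 1"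
    and P: "(\<Sum>n\<in>G. p n) > 0"
    and unif: "\<And>i. i \<in> G \<Longrightarrow> (\<Sum>n\<in>G. p n) \<le> 2 * real (card G) * p i"
    and M: "0 \<le> M" and \<delta>: "0 \<le> \<delta>"
  shows "measure_pmf.expectation (binomial_pmf K (\<Sum>n\<in>G. p n)) (\<lambda>k. Rfun M (card G) k) / 160
         \<le> (\<Sum>d\<in>demands N K. demand_prob p K d * r d) + (real K + 1) * \<delta>"
proof -
  define Q where "Q = (\<Sum>n\<in>G. p n)"
  define \<pi> where "\<pi> T = (\<Sum>d\<in>group_demands N K G T. demand_prob p K d)" for T
  have "Q \<le> 1" unfolding Q_def p1[symmetric] by (rule sum_mono2) (use G p0 in auto)
  then have Q: "Q \<in> {0..1}" using P by (simp add: Q_def)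
  have "measure_pmf.expectation (binomial_pmf K Q) (\<lambda>k. Rfun M (card G) k)
      = (\<Sum>k\<le>K. real (K choose k) * (Q ^ k * (1 - Q) ^ (K - k) * Rfun M (card G) k))"
    unfolding expectation_binomial_pmf'[OF Q] by (simp add: mult_ac)
  also have "\<dots> = (\<Sum>T\<in>Pow {..<K}. Q ^ card T * (1 - Q) ^ (K - card T) * Rfun M (card G) (card T))"
    by (rule sum_Pow_card[symmetric])
  also have "\<dots> = (\<Sum>T\<in>Pow {..<K}. \<pi> T * Rfun M (card G) (card T))"
    unfolding \<pi>_def Q_def using sum_group_demands_prob[OF _ G p1] by (intro sum.cong) auto
  finally have "measure_pmf.expectation (binomial_pmf K Q) (\<lambda>k. Rfun M (card G) k) / 160
      = (\<Sum>T\<in>Pow {..<K}. \<pi> T * (Rfun M (card G) (card T) / 160))"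
    by (simp add: sum_divide_distrib)
  also have "\<dots> = (\<Sum>T\<in>Pow {..<K}. \<pi> T * (Rfun M (card G) (card T) / 160 - (real K + 1) * \<delta>))
      + (\<Sum>T\<in>Pow {..<K}. \<pi> T) * ((real K + 1) * \<delta>)"
    unfolding sum_distrib_right sum.distrib[symmetric] by (intro sum.cong) (auto simp: algebra_simps)
  also have "(\<Sum>T\<in>Pow {..<K}. \<pi> T) = 1"
    unfolding \<pi>_def sum_demands_eq[OF G, symmetric] by (rule sum_demand_prob[OF p1])
  also have "(\<Sum>T\<in>Pow {..<K}. \<pi> T * (Rfun M (card G) (card T) / 160 - (real K + 1) * \<delta>))
      \<le> (\<Sum>T\<in>Pow {..<K}. \<Sum>d\<in>group_demands N K G T. demand_prob p K d * r d)"
    unfolding \<pi>_def by (intro sum_mono group_rate[OF r _ G p0 p1 P unif M \<delta>]) auto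
  also have "\<dots> = (\<Sum>d\<in>demands N K. demand_prob p K d * r d)"
    by (rule sum_demands_eq[OF G, symmetric])
  finally show ?thesis by (simp add: Q_def)
qed

section \<open>From schemes to achievable rates\<close>

lemma achievable_obtain_rates:
  assumes ach: "achievable M N K p R" and M: "0 \<le> M" and e: "e > 0"
  obtains \<delta> r where "cut_set_rates M N K \<delta> r" "0 \<le> \<delta>"
    "(\<Sum>d\<in>demands N K. demand_prob p K d * r d) + (real K + 1) * \<delta> \<le> R + e"
proof -
  \<comment> \<open>The slack \<open>e\<close> is shared equally between achievability and the term
    \<open>(K + 1) / F\<close>; the second argument of \<open>min\<close> makes room for the union
    bound over \<open>N\<close> demand vectors.\<close>
  define eps where "eps = min (e / 2) (1 / (2 * (real N + 1)))"
  have eps: "eps > 0" "eps \<le> e / 2" unfolding eps_def using e by auto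
  have "real N * eps \<le> real N * (1 / (2 * (real N + 1)))"
    unfolding eps_def by (intro mult_left_mono) auto
  also have "\<dots> \<le> 1/2" by (simp add: field_simps)
  finally have Neps: "real N * eps \<le> 1/2" .
  obtain F0 where F0: "\<And>F. F \<ge> F0 \<Longrightarrow> good_scheme M N K p F eps (R + eps)"
    using ach eps unfolding achievable_def by blast
  define F where "F = max (Suc F0) (nat \<lceil>2 * (real K + 1) / e\<rceil>)"
  have F: "F \<ge> F0" "F > 0" unfolding F_def by auto
  have "2 * (real K + 1) / e \<le> real F" unfolding F_def by linarith
  then have KF: "(real K + 1) * (1 / real F) \<le> e / 2" using e F by (simp add: field_simps)
  obtain r where r: "cut_set_rates M N K (1 / real F) r"
    "(\<Sum>d\<in>demands N K. demand_prob p K d * r d) \<le> R + eps"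
    using good_scheme_imp_cut_set_rates[OF F0[OF F(1)] F(2) M eps(1) Neps] by blast
  show ?thesis
  proof (rule that[OF r(1)])
    show "(\<Sum>d\<in>demands N K. demand_prob p K d * r d) + (real K + 1) * (1 / real F) \<le> R + e"
      using r(2) KF eps(2) by linarith
  qed simp
qed

text \<open>Without this \<open>Rstar\<close> could be the unspecified infimum of the empty set.\<close>

lemma achievable_send_all:
  assumes M: "0 \<le> M" and p1: "(\<Sum>n\<in>{1..N}. p n) = 1"
  shows "achievable M N K p (real N)"
  unfolding achievable_def
proof (intro allI impI exI[of _ 1])
  fix eps :: real and F :: nat assume eps: "eps > 0" and F: "1 \<le> F"
  \<comment> \<open>Equal cardinality yields an encoding of the whole library in
    \<open>F * N\<close> bits, sent for every demand and decoded without caches.\<close>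
  have "card (libraries N F) = card {xs :: bool list. length xs = F * N}"
    by (simp add: card_libraries)
  then obtain \<phi> where \<phi>: "bij_betw \<phi> (libraries N F) {xs :: bool list. length xs = F * N}"
    using finite_same_card_bij[OF finite_libraries finite_bool_lists_length] by blast
  define dec :: "nat \<Rightarrow> (nat \<Rightarrow> nat) \<Rightarrow> bool list \<Rightarrow> bool list \<Rightarrow> bool list"
    where "dec k d x c = inv_into (libraries N F) \<phi> x (d k)" for k d x c
  have inv: "inv_into (libraries N F) \<phi> (\<phi> W) = W" if "W \<in> libraries N F" for W
    using \<phi> that by (simp add: bij_betw_def)
  have len: "length (\<phi> W) = F * N" if "W \<in> libraries N F" for W
    using bij_betwE[OF \<phi>] that by blast
  have "{W \<in> libraries N F. \<exists>k<K. dec k d (\<phi> W) [] \<noteq> W (d k)} = {}" for d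
    by (auto simp: dec_def inv)
  then have err: "error_prob N K F (\<lambda>_ _. []) (\<lambda>_. \<phi>) dec d \<le> eps" for d
    unfolding error_prob_def using eps by (simp only: card.empty of_nat_0 div_0 less_imp_le)
  have "(\<Sum>d\<in>demands N K. demand_prob p K d * (real (F * N) / real F)) = real N"
    unfolding sum_distrib_right[symmetric] sum_demand_prob[OF p1] using F by simp
  then have "(\<Sum>d\<in>demands N K. demand_prob p K d * (real (F * N) / real F)) \<le> real N + eps"
    using eps by simp
  then show "good_scheme M N K p F eps (real N + eps)"
    unfolding good_scheme_def using M len err
    by (intro exI[of _ "\<lambda>_ _. []"] exI[of _ "\<lambda>_. \<phi>"] exI[of _ dec] exI[of _ "\<lambda>_. F * N"]) auto
qed

section \<open>Groups of the partition\<close>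

text \<open>A group is an interval from \<open>a\<close> to \<open>e\<close> with
  \<open>p a \<le> 2 * p e\<close>, so monotonicity gives
  \<open>p n \<le> p a \<le> 2 * p e \<le> 2 * p i\<close> for any two of its members.\<close>

lemma group_properties:
  assumes p0: "\<And>n. n \<in> {1..N} \<Longrightarrow> p n > 0"
    and mono: "\<And>n m. n \<in> {1..N} \<Longrightarrow> m \<in> {1..N} \<Longrightarrow> n \<le> m \<Longrightarrow> p m \<le> p n"
    and l: "l < num_groups p N"
  shows "group p N l \<subseteq> {1..N}" "(\<Sum>n\<in>group p N l. p n) > 0"
    "\<And>i. i \<in> group p N l \<Longrightarrow> (\<Sum>n\<in>group p N l. p n) \<le> 2 * real (card (group p N l)) * p i"
proof -
  define a where "a = grp_start p N l"
  define e where "e = grp_end p N a"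
  have aN: "a \<le> N" using not_less_Least[OF l[unfolded num_groups_def]] by (simp add: a_def)
  have a1: "1 \<le> a" unfolding a_def by (cases l) auto
  have "p a > 0" using p0 a1 aN by simp
  then have ain: "a \<in> {m \<in> {a..N}. p m \<ge> p a / 2}" using aN by simp
  have "e \<in> {m \<in> {a..N}. p m \<ge> p a / 2}"
    unfolding e_def grp_end_def by (rule Max_in) (use ain in auto)
  then have e: "a \<le> e" "e \<le> N" "p e \<ge> p a / 2" by auto
  have G: "group p N l = {a..e}" by (simp add: group_def a_def e_def)
  show sub: "group p N l \<subseteq> {1..N}" using G a1 e by auto
  show "(\<Sum>n\<in>group p N l. p n) > 0"
    by (rule sum_pos) (use G e sub p0 in auto)
  fix i assume i: "i \<in> group p N l"
  have "p e \<le> p i" using i G e a1 by (intro mono) auto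
  have "(\<Sum>n\<in>group p N l. p n) \<le> (\<Sum>n\<in>group p N l. 2 * p i)"
  proof (rule sum_mono)
    fix n assume n: "n \<in> group p N l"
    have "p n \<le> p a" using n G e a1 by (intro mono) auto
    then show "p n \<le> 2 * p i" using e \<open>p e \<le> p i\<close> by linarith
  qed
  then show "(\<Sum>n\<in>group p N l. p n) \<le> 2 * real (card (group p N l)) * p i" by simp
qed

theorem theorem2:
  "\<exists>c::real. c > 0 \<and>
    (\<forall>(N::nat) (K::nat) (M::real) (p::nat \<Rightarrow> real).
       N \<ge> 1 \<longrightarrow> M \<ge> 0 \<longrightarrow>
       (\<forall>n\<in>{1..N}. p n > 0) \<longrightarrow>
       (\<forall>n\<in>{1..N}. \<forall>m\<in>{1..N}. n \<le> m \<longrightarrow> p m \<le> p n) \<longrightarrow>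
       (\<Sum>n\<in>{1..N}. p n) = 1 \<longrightarrow>
       Rstar M N K p \<ge>
         1 / (c * real (num_groups p N)) *
         (\<Sum>l<num_groups p N.
            measure_pmf.expectation
              (binomial_pmf K (\<Sum>n\<in>group p N l. p n))
              (\<lambda>k. Rfun M (card (group p N l)) k)))"
proof (intro exI[of _ "160 :: real"] conjI allI impI)
  fix N K :: nat and M :: real and p :: "nat \<Rightarrow> real"
  assume M: "M \<ge> 0" and pos: "\<forall>n\<in>{1..N}. p n > 0"
    and mono: "\<forall>n\<in>{1..N}. \<forall>m\<in>{1..N}. n \<le> m \<longrightarrow> p m \<le> p n"
    and p1: "(\<Sum>n\<in>{1..N}. p n) = 1"
  define L where "L = num_groups p N"
  define E where "E l = measure_pmf.expectation (binomial_pmf K (\<Sum>n\<in>group p N l. p n))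
    (\<lambda>k. Rfun M (card (group p N l)) k)" for l
  have p0: "0 \<le> p n" if "n \<in> {1..N}" for n using pos that by (simp add: less_imp_le)
  \<comment> \<open>An arbitrary \<open>e\<close> absorbs the \<open>\<delta>\<close> terms, which
    vanish only for growing file length.\<close>
  have bound: "1 / (160 * real L) * (\<Sum>l<L. E l) \<le> R" if R: "achievable M N K p R" for R
  proof (rule field_le_epsilon)
    fix e :: real assume "e > 0"
    with R M obtain \<delta> r where r: "cut_set_rates M N K \<delta> r" "0 \<le> \<delta>"
      and Re: "(\<Sum>d\<in>demands N K. demand_prob p K d * r d) + (real K + 1) * \<delta> \<le> R + e"
      by (rule achievable_obtain_rates)
    have El: "E l / 160 \<le> R + e" if "l \<in> {..<L}" for l
    proof -
      have l: "l < num_groups p N" using that by (simp add: L_def)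
      note grp = group_properties[of N p, OF pos[rule_format] mono[rule_format] l]
      have "E l / 160 \<le> (\<Sum>d\<in>demands N K. demand_prob p K d * r d) + (real K + 1) * \<delta>"
        unfolding E_def by (rule expected_group_rate[OF r(1) grp(1) p0 p1 grp(2,3) M r(2)])
      with Re show ?thesis by linarith
    qed
    show "1 / (160 * real L) * (\<Sum>l<L. E l) \<le> R + e"
    proof (cases "L = 0")
      \<comment> \<open>The sum is empty, and what remains is that \<open>R + e\<close> is
        nonnegative.\<close>
      case True
      have "0 \<le> demand_prob p K d * r d" if d: "d \<in> demands N K" for d
      proof (rule mult_nonneg_nonneg)
        show "0 \<le> r d" using r d unfolding cut_set_rates_def by blast
        show "0 \<le> demand_prob p K d"
          using p0 d by (rule demand_prob_nonneg)
      qed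
      then have "0 \<le> (\<Sum>d\<in>demands N K. demand_prob p K d * r d)" by (rule sum_nonneg)
      moreover have "0 \<le> (real K + 1) * \<delta>" using r by simp
      ultimately show ?thesis using True Re by simp
    next
      case False
      \<comment> \<open>Every group alone bounds the full rate; averaging over the groups produces
        the factor \<open>1 / L\<close>.\<close>
      have "(\<Sum>l<L. E l / 160) \<le> real L * (R + e)"
        using sum_bounded_above[of "{..<L}" "\<lambda>l. E l / 160", OF El] by simp
      then show ?thesis using False by (simp add: field_simps flip: sum_divide_distrib)
    qed
  qed
  have "1 / (160 * real L) * (\<Sum>l<L. E l) \<le> Rstar M N K p"
    unfolding Rstar_def
    by (rule cInf_greatest) (use achievable_send_all[OF M p1] bound in auto)
  then show "Rstar M N K p \<ge> 1 / (160 * real (num_groups p N)) *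
      (\<Sum>l<num_groups p N. measure_pmf.expectation (binomial_pmf K (\<Sum>n\<in>group p N l. p n))
        (\<lambda>k. Rfun M (card (group p N l)) k))"
    unfolding L_def E_def .
qed simp

end
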